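(* Let $K\subset\mathbb{R}$ be a compact set with infinitely many points and let $w\colon K\to(0,\infty)$ be continuous. For $D\in\mathbb{N}$, let $\mathcal{Q}_D$ be the set of weighted deep polynomials of composite degree at most $D$ on $K$ with weight $w$. Then for every $f\in C(K)$ and every $\varepsilon>0$ there exist $D\in\mathbb{N}$ and $Q\in\mathcal{Q}_D$ with $\|f-Q\|_{\infty,K}<\varepsilon$. That is, $\bigcup_{D\ge 1}\mathcal{Q}_D$ is dense in $C(K)$.
   Context: $C(K)$ is the space of real-valued continuous functions on $K$ with the uniform norm $\|g\|_{\infty,K}:=\max_{x\in K}|g(x)|$. Polynomials are univariate algebraic polynomials with real coefficients. For $D\in\mathbb{N}$, the set of weighted deep polynomials of composite degree at most $D$ is $$\mathcal{Q}_D=\Bigl\{\,Q=[w]^{\alpha}\,(p_1\circ p_2\circ\cdots\circ p_L)\ :\ L\ge 1,\ \prod_{\ell=1}^{L}\deg(p_\ell)\le D,\ \alpha\ge 0\,\Bigr\},$$ where $p_1,\dots,p_L$ are polynomials, each of degree $\deg(p_\ell)\ge 1$, $\alpha$ is a real number, and $[w]^\alpha$ denotes the pointwise power $x\mapsto w(x)^\alpha$; elements of $\mathcal{Q}_D$ are regarded as functions on $K$. *)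

theory Defs
  imports "HOL-Analysis.Analysis" "HOL-Computational_Algebra.Polynomial"
begin

text \<open>The space \<open>C(K)\<close>, as the metric space of extensional functions (arbitrary value
  \<^const>\<open>undefined\<close> off \<open>K\<close>) that are continuous on \<open>K\<close>, with the uniform distance.\<close>

definition cont_space :: "real set \<Rightarrow> (real \<Rightarrow> real) metric" where
  "cont_space K = cfunspace (top_of_set K) euclidean_metric"

text \<open>For compact nonempty \<open>K\<close> and continuous \<open>g\<close> the supremum is a maximum; see
  \<open>unif_norm_attained\<close>.\<close>

definition unif_norm :: "real set \<Rightarrow> (real \<Rightarrow> real) \<Rightarrow> real" where
  "unif_norm K g = (SUP x\<in>K. \<bar>g x\<bar>)"

text \<open>\<open>[p\<^sub>1, \<dots>, p\<^sub>L]\<close> is sent to \<open>p\<^sub>1 \<circ> \<dots> \<circ> p\<^sub>L\<close>: the last polynomial is applied first.\<close>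

definition poly_chain :: "real poly list \<Rightarrow> real \<Rightarrow> real" where
  "poly_chain ps = foldr (\<lambda>p g. poly p \<circ> g) ps id"

text \<open>Restriction to \<open>K\<close> makes the elements functions on \<open>K\<close>, hence points of \<^const>\<open>cont_space\<close>.\<close>

definition weighted_deep_polys :: "real set \<Rightarrow> (real \<Rightarrow> real) \<Rightarrow> nat \<Rightarrow> (real \<Rightarrow> real) set" where
  "weighted_deep_polys K w D =
     {Q. \<exists>ps \<alpha>. ps \<noteq> [] \<and> (\<forall>p\<in>set ps. degree p \<ge> 1) \<and> prod_list (map degree ps) \<le> D \<and> \<alpha> \<ge> 0 \<and>
           Q = restrict (\<lambda>x. w x powr \<alpha> * poly_chain ps x) K}"

lemma mspace_cont_space:
  assumes "compact K"
  shows "mspace (cont_space K) = {f. f \<in> extensional K \<and> continuous_on K f}"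
proof -
  have "compactin (top_of_set K) (topspace (top_of_set K))"
    using assms by (simp add: compactin_subtopology)
  from compactin_mspace_cfunspace[OF this, of euclidean_metric] show ?thesis
    by (auto simp: cont_space_def)
qed

lemma unif_norm_attained:
  assumes "compact K" "K \<noteq> {}" "continuous_on K g"
  shows "\<exists>x\<in>K. unif_norm K g = \<bar>g x\<bar> \<and> (\<forall>y\<in>K. \<bar>g y\<bar> \<le> \<bar>g x\<bar>)"
proof -
  obtain x where x: "x \<in> K" "\<forall>y\<in>K. \<bar>g y\<bar> \<le> \<bar>g x\<bar>"
    using continuous_attains_sup[OF assms(1,2), of "\<lambda>x. \<bar>g x\<bar>"] assms(3)
    by (auto intro: continuous_intros)
  then have "unif_norm K g = \<bar>g x\<bar>"
    unfolding unif_norm_def by (intro cSup_eq_maximum) auto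
  with x show ?thesis by blast
qed

lemma mdist_cont_space:
  assumes "compact K" and f: "f \<in> mspace (cont_space K)" and g: "g \<in> mspace (cont_space K)"
    and "K \<noteq> {}"
  shows "mdist (cont_space K) f g = unif_norm K (\<lambda>x. f x - g x)"
proof -
  have "f \<in> Met_TC.fspace K" "g \<in> Met_TC.fspace K"
    using f g cfunspace_subset_funspace[of "top_of_set K" "euclidean_metric :: real metric"]
    by (auto simp: cont_space_def)
  then show ?thesis
    using \<open>K \<noteq> {}\<close>
    by (simp add: cont_space_def mdist_cfunspace_eq_mdist_funspace Met_TC.fdist_def
        unif_norm_def dist_real_def)
qed

lemma weighted_deep_polys_subset:
  assumes "compact K" "continuous_on K w" "\<forall>x\<in>K. w x > 0"
  shows "weighted_deep_polys K w D \<subseteq> mspace (cont_space K)"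
proof -
  have "continuous_on K (poly_chain ps)" for ps
    unfolding poly_chain_def
  proof (induction ps)
    case (Cons p ps)
    then show ?case
      by (simp add: o_def id_def continuous_on_poly)
  qed (simp add: id_def)
  moreover have "continuous_on K (\<lambda>x. w x powr \<alpha>)" for \<alpha>
    using assms by (intro continuous_on_powr) (auto intro: continuous_intros)
  ultimately have "continuous_on K (restrict (\<lambda>x. w x powr \<alpha> * poly_chain ps x) K)" for \<alpha> ps
    by (subst continuous_on_cong[OF refl, where g = "\<lambda>x. w x powr \<alpha> * poly_chain ps x"])
       (auto intro!: continuous_on_mult)
  then show ?thesis
    by (auto simp: weighted_deep_polys_def mspace_cont_space[OF assms(1)])
qed

end

theory Submission
  imports Defs
begin

text \<open>The choice \<open>\<alpha> = 0\<close>, \<open>L = 1\<close> already yields every nonconstant polynomial, so density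
  is the Weierstrass approximation theorem; a constant approximant is perturbed by a small
  linear term.\<close>

lemma Weierstrass_nonconstant_poly:
  fixes f :: "real \<Rightarrow> real"
  assumes "compact K" "continuous_on K f" "\<epsilon> > 0"
  obtains p where "degree p \<ge> 1" "\<And>x. x \<in> K \<Longrightarrow> \<bar>f x - poly p x\<bar> < \<epsilon>"
proof -
  \<comment> \<open>Half of \<open>\<epsilon>\<close> is kept in reserve for the linear perturbation
    in the constant case.\<close>
  obtain g where g: "real_polynomial_function g" "\<And>x. x \<in> K \<Longrightarrow> \<bar>f x - g x\<bar> < \<epsilon> / 2"
    using Stone_Weierstrass_real_polynomial_function[OF assms(1,2), of "\<epsilon> / 2"] assms(3)
    by auto
  obtain a n where "g = (\<lambda>x. \<Sum>i\<le>n. a i * x ^ i)"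
    using real_polynomial_function_imp_sum[OF g(1)] by blast
  \<comment> \<open>Passing from a polynomial function to an object of type \<open>real poly\<close>
    gives access to \<open>degree\<close>.\<close>
  then have "g = poly (\<Sum>i\<le>n. monom (a i) i)"
    by (simp add: fun_eq_iff poly_sum poly_monom)
  then obtain q where q: "\<And>x. x \<in> K \<Longrightarrow> \<bar>f x - poly q x\<bar> < \<epsilon> / 2"
    using g(2) by auto
  show thesis
  proof (cases "degree q = 0")
    case False
    have "\<bar>f x - poly q x\<bar> < \<epsilon>" if "x \<in> K" for x
      using q[OF that] assms(3) by linarith
    with False show thesis
      by (intro that[of q]) auto
  next
    case True
    then obtain c where c: "q = [:c:]"
      by (rule degree_eq_zeroE)
    obtain B where B: "B > 0" "\<And>x. x \<in> K \<Longrightarrow> \<bar>x\<bar> \<le> B"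
      using compact_imp_bounded[OF assms(1)] unfolding bounded_pos by auto
    \<comment> \<open>The slope is small enough that the linear term stays within the reserved
      \<open>\<epsilon> / 2\<close> on all of \<open>K\<close>, yet nonzero, so
      \<open>[:c, \<delta>:]\<close> has degree exactly 1.\<close>
    define \<delta> where "\<delta> = \<epsilon> / (2 * B)"
    have \<delta>: "\<delta> > 0" "\<delta> * B = \<epsilon> / 2"
      using B(1) assms(3) by (auto simp: \<delta>_def)
    have "\<bar>f x - poly [:c, \<delta>:] x\<bar> < \<epsilon>" if "x \<in> K" for x
    proof -
      have "\<bar>\<delta> * x\<bar> \<le> \<epsilon> / 2"
        using mult_left_mono[OF B(2)[OF that], of \<delta>] \<delta> by (simp add: abs_mult)
      moreover have "\<bar>f x - c\<bar> < \<epsilon> / 2"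
        using q[OF that] by (simp add: c)
      moreover have "poly [:c, \<delta>:] x = c + \<delta> * x"
        by (simp add: mult.commute)
      ultimately show ?thesis
        by linarith
    qed
    with \<delta>(1) show thesis
      by (intro that[of "[:c, \<delta>:]"]) auto
  qed
qed

lemma weighted_deep_polys_poly:
  assumes "degree p \<ge> 1" "\<forall>x\<in>K. w x > 0"
  shows "restrict (poly p) K \<in> weighted_deep_polys K w (degree p)"
proof -
  \<comment> \<open>Positivity of \<open>w\<close> matters here: \<open>w x powr 0\<close> is 1 for
    nonzero \<open>w x\<close>, whereas \<open>0 powr 0 = 0\<close>.\<close>
  have "restrict (poly p) K = restrict (\<lambda>x. w x powr 0 * poly_chain [p] x) K"
    using assms(2) by (intro restrict_ext) (auto simp: poly_chain_def)
  with assms(1) show ?thesis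
    unfolding weighted_deep_polys_def by (intro CollectI exI[of _ "[p]"] exI[of _ 0]) simp
qed

theorem theorem5p1:
  fixes K :: "real set" and w :: "real \<Rightarrow> real"
  assumes "compact K" and "infinite K"
    and "continuous_on K w" and "\<forall>x\<in>K. w x > 0"
  shows "(\<forall>f. continuous_on K f \<longrightarrow>
           (\<forall>\<epsilon>>0. \<exists>D\<ge>1. \<exists>Q\<in>weighted_deep_polys K w D. unif_norm K (\<lambda>x. f x - Q x) < \<epsilon>))
    \<and> (\<Union>D\<in>{1..}. weighted_deep_polys K w D) \<subseteq> mspace (cont_space K)
    \<and> mtopology_of (cont_space K) closure_of (\<Union>D\<in>{1..}. weighted_deep_polys K w D)
        = mspace (cont_space K)"
proof (intro conjI)
  let ?U = "\<Union>D\<in>{1..}. weighted_deep_polys K w D"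
  have "K \<noteq> {}"
    using assms(2) by auto
  show dense: "\<forall>f. continuous_on K f \<longrightarrow>
      (\<forall>\<epsilon>>0. \<exists>D\<ge>1. \<exists>Q\<in>weighted_deep_polys K w D. unif_norm K (\<lambda>x. f x - Q x) < \<epsilon>)"
  proof (intro allI impI)
    fix f :: "real \<Rightarrow> real" and \<epsilon> :: real
    assume f: "continuous_on K f" and "\<epsilon> > 0"
    then obtain p where p: "degree p \<ge> 1" "\<And>x. x \<in> K \<Longrightarrow> \<bar>f x - poly p x\<bar> < \<epsilon>"
      using Weierstrass_nonconstant_poly[OF assms(1)] by blast
    have "continuous_on K (\<lambda>x. f x - poly p x)"
      using f by (intro continuous_intros)
    \<comment> \<open>Since the supremum is attained at a point of \<open>K\<close>, the strict
      pointwise bound carries over to the norm.\<close>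
    from unif_norm_attained[OF assms(1) \<open>K \<noteq> {}\<close> this]
    have "unif_norm K (\<lambda>x. f x - poly p x) < \<epsilon>"
      using p(2) by auto
    \<comment> \<open>The norm sees only values on \<open>K\<close>, so restricting
      \<open>poly p\<close> changes nothing.\<close>
    then have "unif_norm K (\<lambda>x. f x - restrict (poly p) K x) < \<epsilon>"
      by (simp add: unif_norm_def)
    \<comment> \<open>The witness is \<open>D = degree p\<close>; nonconstancy of \<open>p\<close>
      gives \<open>D \<ge> 1\<close>.\<close>
    with p(1) weighted_deep_polys_poly[OF p(1) assms(4)]
    show "\<exists>D\<ge>1. \<exists>Q\<in>weighted_deep_polys K w D. unif_norm K (\<lambda>x. f x - Q x) < \<epsilon>"
      by blast
  qed
  show sub: "?U \<subseteq> mspace (cont_space K)"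
    using weighted_deep_polys_subset[OF assms(1,3,4)] by blast
  interpret Metric_space "mspace (cont_space K)" "mdist (cont_space K)"
    by (rule Metric_space_mspace_mdist)
  \<comment> \<open>Density restated with balls: \<open>mdist\<close> on \<open>cont_space K\<close>
    is the uniform norm of the difference, so an approximant within \<open>r\<close> of
    \<open>f\<close> lies in \<open>mball f r\<close>.\<close>
  have "\<exists>Q\<in>?U. Q \<in> mball f r" if f: "f \<in> mspace (cont_space K)" and "r > 0" for f r
  proof -
    have "continuous_on K f"
      using f by (simp add: mspace_cont_space[OF assms(1)])
    from dense[rule_format, OF this \<open>r > 0\<close>] obtain D Q where Q: "D \<ge> 1" "Q \<in> weighted_deep_polys K w D"
      "unif_norm K (\<lambda>x. f x - Q x) < r"
      by blast
    then have "Q \<in> ?U"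
      by auto
    moreover from this have "Q \<in> mspace (cont_space K)"
      using sub by (rule rev_subsetD)
    then have "Q \<in> mball f r"
      using f Q(3) mdist_cont_space[OF assms(1) f _ \<open>K \<noteq> {}\<close>] by simp
    ultimately show ?thesis
      by blast
  qed
  \<comment> \<open>By \<open>metric_closure_of\<close>, the closure consists of the points of the
    space all of whose balls meet \<open>?U\<close>; by the previous step these are all its
    points.\<close>
  then show "mtopology_of (cont_space K) closure_of ?U = mspace (cont_space K)"
    unfolding mtopology_of_def metric_closure_of by fast
qed

end
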